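(* Define square matrices $M_{k,q}$ and $M_{k,q}'$ ($k\in\{0,1,2\}$) of size $3^q\times 3^q$ with entries in $\mathbb{Z}[x,y]$ recursively for integers $q\ge 0$ by $M_{0,0}=\begin{bmatrix}1\end{bmatrix}$, $M_{1,0}=\begin{bmatrix}0\end{bmatrix}$, $M_{2,0}=\begin{bmatrix}0\end{bmatrix}$, $M_{0,0}'=\begin{bmatrix}0\end{bmatrix}$, $M_{1,0}'=\begin{bmatrix}1\end{bmatrix}$, $M_{2,0}'=\begin{bmatrix}0\end{bmatrix}$, and, in block form with blocks of size $3^q\times 3^q$ (where $\mathbf{0}$ is the zero block), \[ M_{0,q+1}=\begin{bmatrix} M_{2,q} & M_{2,q} & xM_{0,q}\\ M_{1,q} & \mathbf{0} & \mathbf{0}\\ M_{0,q} & M_{0,q} & \mathbf{0}\end{bmatrix},\quad M_{0,q+1}'=\begin{bmatrix} M_{2,q}' & M_{2,q}' & xM_{0,q}'\\ M_{1,q}' & \mathbf{0} & \mathbf{0}\\ M_{0,q}' & M_{0,q}' & \mathbf{0}\end{bmatrix}, \] \[ M_{1,q+1}=\begin{bmatrix} M_{2,q} & M_{2,q} & xM_{0,q}\\ \mathbf{0} & \mathbf{0} & \mathbf{0}\\ M_{0,q} & M_{0,q} & \mathbf{0}\end{bmatrix},\quad M_{1,q+1}'=\begin{bmatrix} M_{2,q}' & M_{2,q}' & xM_{0,q}'\\ \mathbf{0} & \mathbf{0} & \mathbf{0}\\ M_{0,q}' & M_{0,q}' & \mathbf{0}\end{bmatrix}, \] \[ M_{2,q+1}=\begin{bmatrix}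 yM_{0,q} & yM_{0,q} & \mathbf{0}\\ \mathbf{0} & \mathbf{0} & \mathbf{0}\\ \mathbf{0} & \mathbf{0} & \mathbf{0}\end{bmatrix},\quad M_{2,q+1}'=\begin{bmatrix} yM_{0,q}' & yM_{0,q}' & \mathbf{0}\\ \mathbf{0} & \mathbf{0} & \mathbf{0}\\ \mathbf{0} & \mathbf{0} & \mathbf{0}\end{bmatrix}. \] Then for all positive integers $m,n$, the generating function for the maximal positions of an $m\times n$ Domineering board is \[ F_{m,n}(x,y)=\sum_{u\in\{0,1\}^n}\Big[\big(M_{0,n}+M_{0,n}'\big)^m\Big]_{\,1+\sum_{i=1}^n u_i3^{i-1},\;1}, \] where $[A]_{r,c}$ denotes the entry of the matrix $A$ in row $r$ and column $c$ (rows and columns numbered starting from $1$).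
   Context: An $m\times n$ board is a rectangular grid of unit squares with $m$ rows and $n$ columns. A Domineering position on the board is a set of pairwise non-overlapping dominoes placed on the board, each domino covering exactly two squares sharing an edge; Left's dominoes are vertical (two squares in the same column, in consecutive rows) and Right's dominoes are horizontal (two squares in the same row, in consecutive columns). Alternating play is not assumed, so any such set of dominoes is a position. A maximal position is one in which neither player can place a further domino, i.e., no two squares sharing an edge are both empty. The generating function is $F_{m,n}(x,y)=\sum_{a,b\ge 0} f(a,b)\,x^a y^b$, where $f(a,b)$ is the number of maximal Domineering positions on the $m\times n$ board with exactly $a$ vertical (Left) dominoes and $b$ horizontal (Right) dominoes. *)

theory Defs
  imports
    Jordan_Normal_Form.Matrix
    "HOL-Computational_Algebra.Polynomial"
    "HOL-Library.FuncSet"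
    "HOL-Library.Groups_Big_Fun"
begin

section \<open>Domineering positions\<close>

text \<open>The square in row \<open>i\<close> and column \<open>j\<close> of a board is the pair \<open>(i, j)\<close>,
  counted from 0; a domino is the set of the two squares that it covers.\<close>

type_synonym square = "nat \<times> nat"
type_synonym domino = "square set"

definition vertical_dominoes :: "nat \<Rightarrow> nat \<Rightarrow> domino set" where
  "vertical_dominoes m n = {{(i, j), (Suc i, j)} | i j. Suc i < m \<and> j < n}"

definition horizontal_dominoes :: "nat \<Rightarrow> nat \<Rightarrow> domino set" where
  "horizontal_dominoes m n = {{(i, j), (i, Suc j)} | i j. i < m \<and> Suc j < n}"

definition dominoes :: "nat \<Rightarrow> nat \<Rightarrow> domino set" where
  "dominoes m n = vertical_dominoes m n \<union> horizontal_dominoes m n"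

definition position :: "nat \<Rightarrow> nat \<Rightarrow> domino set \<Rightarrow> bool" where
  "position m n P \<longleftrightarrow> P \<subseteq> dominoes m n \<and> pairwise disjnt P"

text \<open>The two squares of a further domino must both be empty.\<close>

definition maximal_position :: "nat \<Rightarrow> nat \<Rightarrow> domino set \<Rightarrow> bool" where
  "maximal_position m n P \<longleftrightarrow>
     position m n P \<and> \<not> (\<exists>d \<in> dominoes m n. d \<inter> \<Union>P = {})"

definition num_maximal :: "nat \<Rightarrow> nat \<Rightarrow> nat \<Rightarrow> nat \<Rightarrow> nat" where
  "num_maximal m n a b =
     card {P. maximal_position m n P \<and>
              card (P \<inter> vertical_dominoes m n) = a \<and>
              card (P \<inter> horizontal_dominoes m n) = b}"


section \<open>The generating function\<close>

text \<open>The ring \<open>\<int>[x, y]\<close> is represented as \<open>\<int>[x][y]\<close>: \<open>x\<close> is the indeterminate of the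
  coefficient ring.\<close>

type_synonym zxy = "int poly poly"

definition X :: zxy where "X = [:[:0, 1:]:]"
definition Y :: zxy where "Y = [:0, 1:]"

text \<open>The constant \<open>Sum_any\<close> sums over all arguments with a nonzero value, and is 0 if there are
  infinitely many of them; the lemma below excludes that case.\<close>

definition gen_fun :: "nat \<Rightarrow> nat \<Rightarrow> zxy" where
  "gen_fun m n = Sum_any (\<lambda>(a, b). of_nat (num_maximal m n a b) * X ^ a * Y ^ b)"

lemma finite_dominoes: "finite (dominoes m n)"
proof -
  have "vertical_dominoes m n \<subseteq> (\<lambda>(i, j). {(i, j), (Suc i, j)}) ` ({..<m} \<times> {..<n})"
    by (force simp: vertical_dominoes_def)
  moreover have "horizontal_dominoes m n \<subseteq> (\<lambda>(i, j). {(i, j), (i, Suc j)}) ` ({..<m} \<times> {..<n})"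
    by (force simp: horizontal_dominoes_def)
  ultimately show ?thesis
    unfolding dominoes_def by (meson finite_SigmaI finite_UnI finite_imageI finite_lessThan finite_subset)
qed

lemma finite_maximal_positions: "finite {P. maximal_position m n P}"
  by (rule finite_subset[of _ "Pow (dominoes m n)"])
     (auto simp: maximal_position_def position_def finite_dominoes)

lemma finite_support_gen_fun:
  "finite {p. (case p of (a, b) \<Rightarrow>
     of_nat (num_maximal m n a b) * X ^ a * Y ^ b) \<noteq> 0}"
proof (rule finite_subset)
  show "{p. (case p of (a, b) \<Rightarrow> of_nat (num_maximal m n a b) * X ^ a * Y ^ b) \<noteq> 0}
    \<subseteq> (\<lambda>P. (card (P \<inter> vertical_dominoes m n), card (P \<inter> horizontal_dominoes m n)))
         ` {P. maximal_position m n P}"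
  proof clarify
    fix a b
    assume "of_nat (num_maximal m n a b) * X ^ a * Y ^ b \<noteq> 0"
    then have "num_maximal m n a b \<noteq> 0"
      by (metis mult_zero_left of_nat_0)
    then have "{P. maximal_position m n P \<and> card (P \<inter> vertical_dominoes m n) = a \<and>
        card (P \<inter> horizontal_dominoes m n) = b} \<noteq> {}"
      unfolding num_maximal_def by (metis card.empty)
    then show "(a, b) \<in> (\<lambda>P. (card (P \<inter> vertical_dominoes m n),
        card (P \<inter> horizontal_dominoes m n))) ` {P. maximal_position m n P}"
      by auto
  qed
  show "finite ((\<lambda>P. (card (P \<inter> vertical_dominoes m n), card (P \<inter> horizontal_dominoes m n)))
         ` {P. maximal_position m n P})"
    by (intro finite_imageI finite_maximal_positions)
qed


section \<open>The recursively defined matrices\<close>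

text \<open>The \<open>3 \<times> 3\<close> block matrix of the given rows of blocks, each block of size \<open>s \<times> s\<close>.\<close>

definition block3 :: "nat \<Rightarrow> 'a mat list list \<Rightarrow> 'a mat" where
  "block3 s B = mat (3 * s) (3 * s)
     (\<lambda>(i, j). (B ! (i div s) ! (j div s)) $$ (i mod s, j mod s))"

abbreviation Z :: "nat \<Rightarrow> zxy mat" where
  "Z q \<equiv> 0\<^sub>m (3 ^ q) (3 ^ q)"

fun M0 :: "nat \<Rightarrow> zxy mat" and M1 :: "nat \<Rightarrow> zxy mat" and M2 :: "nat \<Rightarrow> zxy mat" where
  "M0 0 = mat_of_rows_list 1 [[1]]"
| "M1 0 = mat_of_rows_list 1 [[0]]"
| "M2 0 = mat_of_rows_list 1 [[0]]"
| "M0 (Suc q) = block3 (3 ^ q)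
     [[M2 q, M2 q, X \<cdot>\<^sub>m M0 q],
      [M1 q, Z q, Z q],
      [M0 q, M0 q, Z q]]"
| "M1 (Suc q) = block3 (3 ^ q)
     [[M2 q, M2 q, X \<cdot>\<^sub>m M0 q],
      [Z q, Z q, Z q],
      [M0 q, M0 q, Z q]]"
| "M2 (Suc q) = block3 (3 ^ q)
     [[Y \<cdot>\<^sub>m M0 q, Y \<cdot>\<^sub>m M0 q, Z q],
      [Z q, Z q, Z q],
      [Z q, Z q, Z q]]"

fun M0' :: "nat \<Rightarrow> zxy mat" and M1' :: "nat \<Rightarrow> zxy mat" and M2' :: "nat \<Rightarrow> zxy mat" where
  "M0' 0 = mat_of_rows_list 1 [[0]]"
| "M1' 0 = mat_of_rows_list 1 [[1]]"
| "M2' 0 = mat_of_rows_list 1 [[0]]"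
| "M0' (Suc q) = block3 (3 ^ q)
     [[M2' q, M2' q, X \<cdot>\<^sub>m M0' q],
      [M1' q, Z q, Z q],
      [M0' q, M0' q, Z q]]"
| "M1' (Suc q) = block3 (3 ^ q)
     [[M2' q, M2' q, X \<cdot>\<^sub>m M0' q],
      [Z q, Z q, Z q],
      [M0' q, M0' q, Z q]]"
| "M2' (Suc q) = block3 (3 ^ q)
     [[Y \<cdot>\<^sub>m M0' q, Y \<cdot>\<^sub>m M0' q, Z q],
      [Z q, Z q, Z q],
      [Z q, Z q, Z q]]"

text \<open>Matrix entries \<open>A $$ (r, c)\<close> are numbered from 0; this is the entry in row \<open>r\<close> and
  column \<open>c\<close> numbered from 1.\<close>

definition entry :: "'a mat \<Rightarrow> nat \<Rightarrow> nat \<Rightarrow> 'a" where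
  "entry A r c = A $$ (r - 1, c - 1)"

end

theory Submission
  imports Defs
begin

text \<open>Fill every square of the board with its role in the position: empty, left or right half of a
  horizontal domino, top or bottom half of a vertical one. Maximal positions are then exactly the
  fillings in which horizontally and vertically adjacent squares satisfy a local compatibility
  condition (\<open>hstep\<close>, \<open>vstep\<close>) and no domino sticks out of the board.

  The matrices form a transfer matrix for this local description. The base-3 digits of a row index
  record, for each square of a board row, whether it is empty (1), a bottom half (2) or anything
  else (0); the digits of the column index record the same for the board row below. The subscript
  \<open>k\<close> records what the left neighbour of the next square is: empty (1), a left half (2), or
  anything else (0). Hence the entries of \<open>M\<^sub>k + M\<^sub>k'\<close> sum the weights of the admissible fillings
  of one row, and those of its \<open>m\<close>-th power the weights of stacks of \<open>m\<close> rows: column 0 forbids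
  vertical dominoes leaving the bottom row, and the digits \<open>u\<^sub>i \<in> {0, 1}\<close> forbid bottom halves in
  the top row.\<close>

section \<open>Cells, their local conditions, and base-3 codes of rows\<close>

datatype cell = Empty | HL | HR | VT | VB

lemma UNIV_cell: "UNIV = {Empty, HL, HR, VT, VB}"
  by (auto intro: cell.exhaust)

instance cell :: finite
  by standard (simp add: UNIV_cell)

text \<open>Horizontal dominoes are counted at their right half because \<open>M\<^sub>2\<close> carries the factor \<open>y\<close>.\<close>

fun wt :: "cell \<Rightarrow> zxy" where
  "wt VT = X" | "wt HR = Y" | "wt _ = 1"

text \<open>The equivalence joins the two halves of a domino. The second conjunct is maximality,
  expressed between neighbours.\<close>

definition hstep :: "cell \<Rightarrow> cell \<Rightarrow> bool" where
  "hstep a b \<longleftrightarrow> (a = HL \<longleftrightarrow> b = HR) \<and> \<not> (a = Empty \<and> b = Empty)"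

definition vstep :: "cell \<Rightarrow> cell \<Rightarrow> bool" where
  "vstep a b \<longleftrightarrow> (a = VT \<longleftrightarrow> b = VB) \<and> \<not> (a = Empty \<and> b = Empty)"

fun digit :: "cell \<Rightarrow> nat" where
  "digit Empty = 1" | "digit VB = 2" | "digit _ = 0"

text \<open>Whether a square may lie above a square with the given digit.\<close>

fun fits :: "cell \<Rightarrow> nat \<Rightarrow> bool" where
  "fits Empty d \<longleftrightarrow> d = 0" | "fits VT d \<longleftrightarrow> d = 2" | "fits _ d \<longleftrightarrow> d < 2"

lemma fits_digit: "fits a (digit b) \<longleftrightarrow> vstep a b"
  by (cases a; cases b) (auto simp: vstep_def)

lemma digit_less: "digit a < 3"
  by (cases a) auto

text \<open>The first argument is the left neighbour of the row; at the border of the board \<open>VT\<close> is used,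
  which imposes the same condition as a wall.\<close>

fun row_ok :: "cell \<Rightarrow> cell list \<Rightarrow> bool" where
  "row_ok a [] \<longleftrightarrow> a \<noteq> HL"
| "row_ok a (b # w) \<longleftrightarrow> hstep a b \<and> row_ok b w"

fun code :: "cell list \<Rightarrow> nat" where
  "code [] = 0"
| "code (b # w) = digit b * 3 ^ length w + code w"

text \<open>The second argument is a number because only the digits of the row below matter. The
  leftmost square owns the most significant digit, just as the outermost block structure of the
  matrices describes the first square.\<close>

fun fits_row :: "cell list \<Rightarrow> nat \<Rightarrow> bool" where
  "fits_row [] c \<longleftrightarrow> True"
| "fits_row (b # w) c \<longleftrightarrow> fits b (c div 3 ^ length w) \<and> fits_row w (c mod 3 ^ length w)"

lemma code_less: "code w < 3 ^ length w"
proof (induction w)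
  case (Cons b w)
  have "digit b * 3 ^ length w \<le> 2 * 3 ^ length w"
    using digit_less[of b] by (intro mult_right_mono) auto
  with Cons show ?case by (simp only: code.simps list.size add_Suc_right add_0_right power_Suc)
qed simp

lemma fits_row_code:
  "length w = length v \<Longrightarrow> fits_row w (code v) \<longleftrightarrow> list_all2 vstep w v"
  by (induction w v rule: list_induct2) (simp_all add: code_less fits_digit)

lemma fits_row_0: "fits_row w 0 \<longleftrightarrow> VT \<notin> set w"
proof (induction w)
  case (Cons b w)
  then show ?case by (cases b) auto
qed simp

text \<open>Uniqueness of quotient and remainder: \<open>code w\<close> and \<open>s\<close> both
  lie below \<open>3 ^ length w\<close>.\<close>

lemma code_eq_iff:
  assumes "s < 3 ^ length w"
  shows "code (b # w) = d * 3 ^ length w + s \<longleftrightarrow> digit b = d \<and> code w = s"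
proof
  assume eq: "code (b # w) = d * 3 ^ length w + s"
  from arg_cong[OF eq, of "\<lambda>x. x div 3 ^ length w"] arg_cong[OF eq, of "\<lambda>x. x mod 3 ^ length w"]
  show "digit b = d \<and> code w = s"
    using assms code_less[of w] by simp
qed auto

section \<open>Sums over words and the entries of the matrices\<close>

abbreviation words :: "'a set \<Rightarrow> nat \<Rightarrow> 'a list set" where
  "words A k \<equiv> {w. set w \<subseteq> A \<and> length w = k}"

lemma sum_words_Suc:
  "(\<Sum>w\<in>words A (Suc k). f w) = (\<Sum>a\<in>A. \<Sum>w\<in>words A k. f (a # w))"
proof -
  have "(\<Sum>w\<in>words A (Suc k). f w) = (\<Sum>(w, a)\<in>words A k \<times> A. f (a # w))"
    unfolding lists_length_Suc_eq
    by (subst sum.reindex) (auto intro!: inj_onI sum.cong)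
  also have "\<dots> = (\<Sum>w\<in>words A k. \<Sum>a\<in>A. f (a # w))"
    by (simp add: sum.cartesian_product)
  also have "\<dots> = (\<Sum>a\<in>A. \<Sum>w\<in>words A k. f (a # w))"
    by (rule sum.swap)
  finally show ?thesis .
qed

lemma sum_words_0: "(\<Sum>w\<in>words A 0. f w) = f []"
proof -
  have "words A 0 = {[]}" by auto
  then show ?thesis by simp
qed

text \<open>The left neighbour \<open>a\<close> selects the subscript. The recursion is linear, so
  the sum with the primed matrix obeys it too. At size \<open>q = 0\<close> the entry is 0 for
  \<open>HL\<close> and 1 otherwise: a row may end in anything but a left half.\<close>

definition N :: "cell \<Rightarrow> nat \<Rightarrow> zxy mat" where
  "N a q = (case a of HL \<Rightarrow> M2 q + M2' q | Empty \<Rightarrow> M1 q + M1' q | _ \<Rightarrow> M0 q + M0' q)"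

lemma block3_carrier: "block3 s B \<in> carrier_mat (3 * s) (3 * s)"
  by (simp add: block3_def)

lemma M_carrier [simp]:
  "M0 q \<in> carrier_mat (3 ^ q) (3 ^ q)" "M1 q \<in> carrier_mat (3 ^ q) (3 ^ q)"
  "M2 q \<in> carrier_mat (3 ^ q) (3 ^ q)" "M0' q \<in> carrier_mat (3 ^ q) (3 ^ q)"
  "M1' q \<in> carrier_mat (3 ^ q) (3 ^ q)" "M2' q \<in> carrier_mat (3 ^ q) (3 ^ q)"
  by (cases q; simp add: block3_carrier mat_of_rows_list_def)+

lemma M_dim [simp]:
  "dim_row (M0 q) = 3 ^ q" "dim_col (M0 q) = 3 ^ q" "dim_row (M1 q) = 3 ^ q" "dim_col (M1 q) = 3 ^ q"
  "dim_row (M2 q) = 3 ^ q" "dim_col (M2 q) = 3 ^ q" "dim_row (M0' q) = 3 ^ q" "dim_col (M0' q) = 3 ^ q"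
  "dim_row (M1' q) = 3 ^ q" "dim_col (M1' q) = 3 ^ q" "dim_row (M2' q) = 3 ^ q" "dim_col (M2' q) = 3 ^ q"
  using M_carrier by (blast dest: carrier_matD)+

lemma N_carrier [simp]: "N a q \<in> carrier_mat (3 ^ q) (3 ^ q)"
  by (cases a) (simp_all add: N_def)

text \<open>The three block recursions in one formula. The block row prescribes the digit of the
  next cell \<open>b\<close>, the block column the digit below it. For each block at most one
  \<open>b\<close> satisfies all conditions; it supplies the factor \<open>wt b\<close> and the
  subscript of the block.\<close>

lemma N_Suc:
  assumes "r < 3 ^ Suc q" "c < 3 ^ Suc q"
  shows "N a (Suc q) $$ (r, c) =
    (\<Sum>b\<in>UNIV. of_bool (hstep a b \<and> digit b = r div 3 ^ q \<and> fits b (c div 3 ^ q)) *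
        (wt b * N b q $$ (r mod 3 ^ q, c mod 3 ^ q)))"
proof -
  have *: "x div 3 ^ q \<in> {0, 1, 2}" if "x < 3 ^ Suc q" for x :: nat
    using that less_mult_imp_div_less[of x 3 "3 ^ q"] by auto
  have "r div 3 ^ q \<in> {0, 1, 2}" "c div 3 ^ q \<in> {0, 1, 2}"
    using assms * by auto
  then show ?thesis
    using assms
    by (cases a; elim insertE emptyE)
       (simp_all add: N_def block3_def UNIV_cell hstep_def algebra_simps)
qed

text \<open>Induction on the row length by \<open>N_Suc\<close>: the leftmost cell is split off and
  becomes the left neighbour of the rest.\<close>

lemma N_entry:
  assumes "r < 3 ^ q" "c < 3 ^ q"
  shows "N a q $$ (r, c) =
    (\<Sum>w\<in>words UNIV q. of_bool (row_ok a w \<and> code w = r \<and> fits_row w c) * prod_list (map wt w))"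
  using assms
proof (induction q arbitrary: a r c)
  case 0
  then show ?case
    by (cases a) (simp_all add: N_def sum_words_0 mat_of_rows_list_def)
next
  case (Suc q)
  have code: "code (b # w) = r \<longleftrightarrow> digit b = r div 3 ^ q \<and> code w = r mod 3 ^ q"
    if "length w = q" for b w
    using code_eq_iff[of "r mod 3 ^ q" w b "r div 3 ^ q"] that by (simp only: div_mult_mod_eq) simp
  show ?case
    unfolding N_Suc[OF Suc.prems] sum_words_Suc
    by (intro sum.cong refl)
       (auto simp: Suc.IH sum_distrib_left code simp del: code.simps intro!: sum.cong)
qed

section \<open>Stacks of rows and powers of the matrix\<close>

text \<open>Below the last row, digits 0 forbid top halves and nothing else.\<close>

fun top :: "cell list list \<Rightarrow> nat" where
  "top [] = 0" | "top (w # G) = code w"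

text \<open>Nothing is required above the first row, so bottom halves are still allowed there; the
  binary digits remove them later.\<close>

fun grid_ok :: "cell list list \<Rightarrow> bool" where
  "grid_ok [] \<longleftrightarrow> True"
| "grid_ok (w # G) \<longleftrightarrow> row_ok VT w \<and> fits_row w (top G) \<and> grid_ok G"

abbreviation grids :: "nat \<Rightarrow> nat \<Rightarrow> cell list list set" where
  "grids m n \<equiv> words (words UNIV n) m"

definition gwt :: "cell list list \<Rightarrow> zxy" where
  "gwt G = prod_list (map (\<lambda>w. prod_list (map wt w)) G)"

lemma finite_words: "finite A \<Longrightarrow> finite (words A k)"
  by (rule finite_lists_length_eq)

text \<open>A factor on the left corresponds to a new row on top of a grid.\<close>

lemma pow_mat_Suc_left:
  assumes "A \<in> carrier_mat n n"
  shows "A ^\<^sub>m Suc k = A * A ^\<^sub>m k"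
  using assms
proof (induction k)
  case (Suc k)
  have "A ^\<^sub>m Suc (Suc k) = (A * A ^\<^sub>m k) * A"
    using Suc by simp
  also have "\<dots> = A * (A ^\<^sub>m k * A)"
    using Suc.prems by (intro assoc_mult_mat) auto
  finally show ?case by simp
qed simp

lemma top_less: "G \<in> grids m n \<Longrightarrow> top G < 3 ^ n"
  by (cases G) (auto intro: code_less)

text \<open>Transfer-matrix argument: the summation index \<open>c\<close> of the matrix product
  links the new row \<open>w\<close> to the grid \<open>G\<close> below it, and only
  \<open>c = top G\<close> contributes. For \<open>m = 0\<close>, column 0 of the identity matrix
  agrees with \<open>top [] = 0\<close>.\<close>

lemma power_entry:
  assumes "r < 3 ^ n"
  shows "(N VT n ^\<^sub>m m) $$ (r, 0) =
    (\<Sum>G\<in>grids m n. of_bool (grid_ok G \<and> top G = r) * gwt G)"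
  using assms
proof (induction m arbitrary: r)
  case 0
  have "dim_row (N VT n) = 3 ^ n" by (simp add: N_def)
  with 0 show ?case
    by (subst sum_words_0) (simp add: gwt_def)
next
  case (Suc m)
  let ?A = "N VT n" and ?W = "words UNIV n :: cell list set"
  let ?p = "\<lambda>w. prod_list (map wt w)"
  have "(?A ^\<^sub>m Suc m) $$ (r, 0) = (?A * ?A ^\<^sub>m m) $$ (r, 0)"
    by (subst pow_mat_Suc_left[of _ "3 ^ n"]) auto
  also have "\<dots> = (\<Sum>c<3 ^ n. ?A $$ (r, c) * (?A ^\<^sub>m m) $$ (c, 0))"
  proof -
    have d: "dim_row ?A = 3 ^ n" "dim_col ?A = 3 ^ n" by (simp_all add: N_def)
    show ?thesis
      using Suc.prems by (simp add: scalar_prod_def d lessThan_atLeast0)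
  qed
  also have "\<dots> = (\<Sum>c<3 ^ n. \<Sum>w\<in>?W. \<Sum>G\<in>grids m n.
      of_bool (row_ok VT w \<and> code w = r \<and> fits_row w c) * ?p w *
      (of_bool (grid_ok G \<and> top G = c) * gwt G))"
    using Suc.prems by (intro sum.cong refl) (simp add: N_entry Suc.IH sum_product)
  also have "\<dots> = (\<Sum>w\<in>?W. \<Sum>G\<in>grids m n. \<Sum>c<3 ^ n.
      of_bool (row_ok VT w \<and> code w = r \<and> fits_row w c) * ?p w *
      (of_bool (grid_ok G \<and> top G = c) * gwt G))"
    by (subst sum.swap, rule sum.cong[OF refl], rule sum.swap)
  also have "\<dots> = (\<Sum>w\<in>?W. \<Sum>G\<in>grids m n.
      of_bool (grid_ok (w # G) \<and> top (w # G) = r) * gwt (w # G))"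
  proof (intro sum.cong refl)
    fix w :: "cell list" and G assume "G \<in> grids m n"
    then have "top G < 3 ^ n" by (rule top_less)
    have "(\<Sum>c<3 ^ n. of_bool (row_ok VT w \<and> code w = r \<and> fits_row w c) * ?p w *
        (of_bool (grid_ok G \<and> top G = c) * gwt G)) =
      (\<Sum>c<3 ^ n. if top G = c
         then of_bool (grid_ok (w # G) \<and> top (w # G) = r) * gwt (w # G) else 0)"
      by (intro sum.cong) (auto simp: gwt_def)
    then show "(\<Sum>c<3 ^ n. of_bool (row_ok VT w \<and> code w = r \<and> fits_row w c) * ?p w *
        (of_bool (grid_ok G \<and> top G = c) * gwt G)) =
      of_bool (grid_ok (w # G) \<and> top (w # G) = r) * gwt (w # G)"
      using \<open>top G < 3 ^ n\<close> by (simp only: sum.delta' finite_lessThan lessThan_iff if_True)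
  qed
  also have "\<dots> = (\<Sum>G\<in>grids (Suc m) n. of_bool (grid_ok G \<and> top G = r) * gwt G)"
    by (simp only: sum_words_Suc)
  finally show ?case .
qed

section \<open>Selecting the admissible top rows by binary digits\<close>

lemma sum_digits_less:
  "u \<in> {1..n} \<rightarrow>\<^sub>E {0, 1::nat} \<Longrightarrow> (\<Sum>i = 1..n. u i * 3 ^ (i - 1)) < (3 :: nat) ^ n"
proof (induction n arbitrary: u)
  case (Suc n)
  have u: "u (Suc n) \<le> 1" using Suc.prems by (force simp: PiE_iff)
  \<comment> \<open>The induction hypothesis concerns functions that are extensional on
    \<open>{1..n}\<close>, hence the restriction.\<close>
  have "(\<Sum>i = 1..n. u i * 3 ^ (i - 1)) = (\<Sum>i = 1..n. restrict u {1..n} i * 3 ^ (i - 1))"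
    by (intro sum.cong) auto
  also have "\<dots> < 3 ^ n"
    using Suc.prems by (intro Suc.IH restrict_PiE_iff[THEN iffD2]) (auto simp: PiE_iff)
  finally have "(\<Sum>i = 1..n. u i * 3 ^ (i - 1)) < 3 ^ n" .
  moreover have "u (Suc n) * 3 ^ n \<le> 1 * 3 ^ n" using u by (intro mult_right_mono) auto
  moreover have "(\<Sum>i = 1..Suc n. u i * 3 ^ (i - 1)) = (\<Sum>i = 1..n. u i * 3 ^ (i - 1)) + u (Suc n) * 3 ^ n"
    by simp
  ultimately show ?case unfolding power_Suc by linarith
qed simp

text \<open>Base-3 digits are unique, so at most one \<open>u\<close> matches, and one does exactly
  when no digit of \<open>code w\<close> is 2. The digit 2 occurs only for
  \<open>VB\<close>.\<close>

lemma sum_binary_digits: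
  "length w = n \<Longrightarrow> (\<Sum>u\<in>{1..n} \<rightarrow>\<^sub>E {0, 1::nat}. of_bool (code w = (\<Sum>i = 1..n. u i * 3 ^ (i - 1)))) =
    (of_bool (VB \<notin> set w) :: zxy)"
proof (induction n arbitrary: w)
  case 0
  then show ?case by simp
next
  case (Suc n)
  obtain b w' where w: "w = b # w'" "length w' = n" using Suc.prems by (cases w) auto
  let ?U = "{1..n} \<rightarrow>\<^sub>E {0, 1::nat}"
  let ?s = "\<lambda>n u. \<Sum>i = 1..n. u i * 3 ^ (i - 1) :: nat"
  have ins: "{1..Suc n} = insert (Suc n) {1..n}" by auto
  have s: "?s (Suc n) (u(Suc n := d)) = d * 3 ^ n + ?s n u" for u d
  proof -
    have "?s n (u(Suc n := d)) = ?s n u" by (intro sum.cong) auto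
    then show ?thesis by simp
  qed
  \<comment> \<open>The value \<open>u (Suc n)\<close> is the most significant digit and is compared
    with the first cell \<open>b\<close>.\<close>
  have "(\<Sum>u\<in>{1..Suc n} \<rightarrow>\<^sub>E {0, 1::nat}. of_bool (code w = ?s (Suc n) u)) =
    (\<Sum>(d, u)\<in>{0, 1} \<times> ?U. of_bool (code w = ?s (Suc n) (u(Suc n := d))) :: zxy)"
    unfolding ins PiE_insert_eq
    by (subst sum.reindex) (auto intro!: inj_combinator sum.cong)
  also have "\<dots> = (\<Sum>d\<in>{0, 1}. \<Sum>u\<in>?U. of_bool (digit b = d) * of_bool (code w' = ?s n u))"
    unfolding sum.cartesian_product[symmetric] s
  proof (intro sum.cong refl)
    fix d u assume "u \<in> ?U"
    then show "of_bool (code w = d * 3 ^ n + ?s n u) =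
      (of_bool (digit b = d) * of_bool (code w' = ?s n u) :: zxy)"
      using code_eq_iff[of "?s n u" w' b d] sum_digits_less[of u n] w by simp
  qed
  also have "\<dots> = (\<Sum>d\<in>{0, 1}. of_bool (digit b = d) * of_bool (VB \<notin> set w'))"
    by (simp only: sum_distrib_left[symmetric] Suc.IH[OF w(2)])
  also have "\<dots> = of_bool (VB \<notin> set w)"
    unfolding w by (cases b) auto
  finally show ?case .
qed

section \<open>Fillings of the board described cell by cell\<close>

definition tiling :: "nat \<Rightarrow> nat \<Rightarrow> (nat \<Rightarrow> nat \<Rightarrow> cell) \<Rightarrow> bool" where
  "tiling m n t \<longleftrightarrow> (\<forall>i<m. \<forall>j<n.
     (t i j = HL \<longrightarrow> Suc j < n) \<and> (t i j = HR \<longrightarrow> j \<noteq> 0) \<and>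
     (t i j = VT \<longrightarrow> Suc i < m) \<and> (t i j = VB \<longrightarrow> i \<noteq> 0) \<and>
     (Suc j < n \<longrightarrow> hstep (t i j) (t i (Suc j))) \<and>
     (Suc i < m \<longrightarrow> vstep (t i j) (t (Suc i) j)))"

lemma row_ok_iff:
  "row_ok a w \<longleftrightarrow> (\<forall>j<length w. hstep ((a # w) ! j) (w ! j)) \<and> last (a # w) \<noteq> HL"
  by (induction a w rule: row_ok.induct) (auto simp: less_Suc_eq_0_disj)

text \<open>\<open>hstep VT b\<close> amounts to \<open>b \<noteq> HR\<close>, so the fictitious
  left neighbour keeps right halves from sticking out on the left. The condition on the last cell
  does the same for left halves on the right.\<close>

lemma row_ok_VT_iff:
  "row_ok VT w \<longleftrightarrow> (\<forall>j<length w. (w ! j = HL \<longrightarrow> Suc j < length w) \<and> (w ! j = HR \<longrightarrow> j \<noteq> 0) \<and>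
     (Suc j < length w \<longrightarrow> hstep (w ! j) (w ! Suc j)))"
proof (cases w)
  case (Cons b v)
  have l: "last (VT # w) = w ! (length w - 1)"
    using last_conv_nth[of w] by (simp add: Cons)
  have "last (VT # w) \<noteq> HL \<longleftrightarrow> (\<forall>j<length w. w ! j = HL \<longrightarrow> Suc j < length w)"
  proof
    assume *: "last (VT # w) \<noteq> HL"
    show "\<forall>j<length w. w ! j = HL \<longrightarrow> Suc j < length w"
    proof (intro allI impI)
      fix j assume j: "j < length w" "w ! j = HL"
      then have "j \<noteq> length w - 1" using * l by auto
      with j(1) show "Suc j < length w" by simp
    qed
  next
    assume "\<forall>j<length w. w ! j = HL \<longrightarrow> Suc j < length w"
    from this[rule_format, of "length w - 1"] show "last (VT # w) \<noteq> HL"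
      unfolding l by (auto simp: Cons)
  qed
  moreover have "(\<forall>j<length w. hstep ((VT # w) ! j) (w ! j)) \<longleftrightarrow>
     (\<forall>j<length w. (w ! j = HR \<longrightarrow> j \<noteq> 0) \<and> (Suc j < length w \<longrightarrow> hstep (w ! j) (w ! Suc j)))"
  proof
    assume *: "\<forall>j<length w. hstep ((VT # w) ! j) (w ! j)"
    show "\<forall>j<length w. (w ! j = HR \<longrightarrow> j \<noteq> 0) \<and> (Suc j < length w \<longrightarrow> hstep (w ! j) (w ! Suc j))"
    proof (intro allI impI)
      fix j assume "j < length w"
      then show "(w ! j = HR \<longrightarrow> j \<noteq> 0) \<and> (Suc j < length w \<longrightarrow> hstep (w ! j) (w ! Suc j))"
        using *[rule_format, of j] *[rule_format, of "Suc j"] by (cases j) (auto simp: hstep_def)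
    qed
  next
    assume *: "\<forall>j<length w. (w ! j = HR \<longrightarrow> j \<noteq> 0) \<and> (Suc j < length w \<longrightarrow> hstep (w ! j) (w ! Suc j))"
    show "\<forall>j<length w. hstep ((VT # w) ! j) (w ! j)"
    proof (intro allI impI)
      fix j assume "j < length w"
      then show "hstep ((VT # w) ! j) (w ! j)"
        using * by (cases j) (auto simp: hstep_def)
    qed
  qed
  ultimately show ?thesis
    unfolding row_ok_iff by blast
qed simp

lemma grid_ok_iff:
  "grid_ok G \<longleftrightarrow> (\<forall>i<length G. row_ok VT (G ! i) \<and> fits_row (G ! i) (top (drop (Suc i) G)))"
  by (induction G) (auto simp: less_Suc_eq_0_disj)

lemma grid_nth_length: "G \<in> grids m n \<Longrightarrow> i < m \<Longrightarrow> length (G ! i) = n"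
  by (auto simp: subset_iff)

text \<open>\<open>row_ok VT\<close> yields the horizontal conditions and \<open>fits_row\<close>
  those towards the row below; under the last row the index is 0, which forbids top halves. Only the
  upper border is left, hence the extra condition on the first row.\<close>

lemma tiling_grid_iff:
  assumes G: "G \<in> grids m n"
  shows "tiling m n (\<lambda>i j. G ! i ! j) \<longleftrightarrow> grid_ok G \<and> (m \<noteq> 0 \<longrightarrow> VB \<notin> set (G ! 0))"
proof -
  have [simp]: "length G = m" using G by simp
  have fits: "fits_row (G ! i) (top (drop (Suc i) G)) \<longleftrightarrow>
      (\<forall>j<n. (G ! i ! j = VT \<longrightarrow> Suc i < m) \<and> (Suc i < m \<longrightarrow> vstep (G ! i ! j) (G ! Suc i ! j)))"
    if i: "i < m" for i
  proof (cases "Suc i < m")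
    case True
    then have "drop (Suc i) G = G ! Suc i # drop (Suc (Suc i)) G"
      by (simp add: Cons_nth_drop_Suc)
    then show ?thesis
      using True i grid_nth_length[OF G] by (simp add: fits_row_code list_all2_conv_all_nth)
  next
    case False
    then show ?thesis
      using i grid_nth_length[OF G, of i] by (auto simp: fits_row_0 in_set_conv_nth)
  qed
  have "(m \<noteq> 0 \<longrightarrow> VB \<notin> set (G ! 0)) \<longleftrightarrow> (\<forall>i<m. \<forall>j<n. G ! i ! j = VB \<longrightarrow> i \<noteq> 0)"
    using grid_nth_length[OF G, of 0] by (auto simp: in_set_conv_nth) (metis gr0I)
  then show ?thesis
    unfolding tiling_def grid_ok_iff
    using grid_nth_length[OF G] by (auto simp: fits row_ok_VT_iff)
qed

lemma sum_entries:
  assumes "m \<ge> 1"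
  shows "(\<Sum>u \<in> {1..n} \<rightarrow>\<^sub>E {0, 1::nat}.
       entry ((M0 n + M0' n) ^\<^sub>m m) (1 + (\<Sum>i = 1..n. u i * 3 ^ (i - 1))) 1) =
    (\<Sum>G | G \<in> grids m n \<and> tiling m n (\<lambda>i j. G ! i ! j). gwt G)"
proof -
  let ?U = "{1..n} \<rightarrow>\<^sub>E {0, 1::nat}" and ?s = "\<lambda>u. \<Sum>i = 1..n. u i * 3 ^ (i - 1) :: nat"
  have N: "M0 n + M0' n = N VT n" by (simp add: N_def)
  have "(\<Sum>u\<in>?U. entry ((M0 n + M0' n) ^\<^sub>m m) (1 + ?s u) 1) =
    (\<Sum>u\<in>?U. \<Sum>G\<in>grids m n. of_bool (grid_ok G \<and> top G = ?s u) * gwt G)"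
  proof (rule sum.cong[OF refl])
    fix u assume "u \<in> ?U"
    from power_entry[OF sum_digits_less[OF this], of m]
    show "entry ((M0 n + M0' n) ^\<^sub>m m) (1 + ?s u) 1 =
      (\<Sum>G\<in>grids m n. of_bool (grid_ok G \<and> top G = ?s u) * gwt G)"
      by (simp only: entry_def N diff_add_inverse diff_self_eq_0)
  qed
  also have "\<dots> = (\<Sum>G\<in>grids m n. \<Sum>u\<in>?U. of_bool (grid_ok G \<and> top G = ?s u) * gwt G)"
    by (rule sum.swap)
  also have "\<dots> = (\<Sum>G\<in>grids m n. if tiling m n (\<lambda>i j. G ! i ! j) then gwt G else 0)"
  proof (rule sum.cong[OF refl])
    fix G assume G: "G \<in> grids m n"
    \<comment> \<open>Here \<open>m \<ge> 1\<close> provides the top row that the digits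
      \<open>u\<close> are compared with.\<close>
    with assms obtain w G' where w: "G = w # G'" "length w = n" by (cases G) auto
    have "(\<Sum>u\<in>?U. of_bool (grid_ok G \<and> top G = ?s u) * gwt G) =
      of_bool (grid_ok G) * gwt G * (\<Sum>u\<in>?U. of_bool (code w = ?s u))"
      by (auto simp: w(1) sum_distrib_left intro!: sum.cong)
    also have "\<dots> = of_bool (grid_ok G \<and> VB \<notin> set w) * gwt G"
      unfolding sum_binary_digits[OF w(2)] by auto
    also have "\<dots> = (if tiling m n (\<lambda>i j. G ! i ! j) then gwt G else 0)"
      unfolding tiling_grid_iff[OF G] using assms w by auto
    finally show "(\<Sum>u\<in>?U. of_bool (grid_ok G \<and> top G = ?s u) * gwt G) =
      (if tiling m n (\<lambda>i j. G ! i ! j) then gwt G else 0)" .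
  qed
  also have "\<dots> = (\<Sum>G | G \<in> grids m n \<and> tiling m n (\<lambda>i j. G ! i ! j). gwt G)"
    by (simp only: sum.inter_filter[symmetric] finite_words finite_code)
  finally show ?thesis .
qed

lemma gwt_eq:
  assumes G: "G \<in> grids m n"
  shows "gwt G = X ^ card {(i, j). i < m \<and> j < n \<and> G ! i ! j = VT} *
                 Y ^ card {(i, j). i < m \<and> j < n \<and> G ! i ! j = HR}"
proof -
  have wt: "wt c = (if c = VT then X else 1) * (if c = HR then Y else 1)" for c
    by (cases c) auto
  have "gwt G = (\<Prod>i<m. \<Prod>j<n. wt (G ! i ! j))"
    unfolding gwt_def prod.list_conv_set_nth
    using G grid_nth_length[OF G]
    by (auto simp: lessThan_atLeast0 intro!: prod.cong)
  also have "\<dots> = (\<Prod>(i, j)\<in>{..<m} \<times> {..<n}. wt (G ! i ! j))"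
    by (rule prod.cartesian_product)
  also have "\<dots> = (\<Prod>p\<in>{..<m} \<times> {..<n}. if G ! fst p ! snd p = VT then X else 1) *
     (\<Prod>p\<in>{..<m} \<times> {..<n}. if G ! fst p ! snd p = HR then Y else 1)"
    unfolding prod.distrib[symmetric] by (intro prod.cong) (auto simp: wt)
  also have "\<dots> = X ^ card {p \<in> {..<m} \<times> {..<n}. G ! fst p ! snd p = VT} *
     Y ^ card {p \<in> {..<m} \<times> {..<n}. G ! fst p ! snd p = HR}"
    by (simp add: prod.inter_filter[symmetric])
  finally have "gwt G = X ^ card {p \<in> {..<m} \<times> {..<n}. G ! fst p ! snd p = VT} *
     Y ^ card {p \<in> {..<m} \<times> {..<n}. G ! fst p ! snd p = HR}" .
  moreover have "{p \<in> {..<m} \<times> {..<n}. G ! fst p ! snd p = c} =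
      {(i, j). i < m \<and> j < n \<and> G ! i ! j = c}" for c
    by auto
  ultimately show ?thesis by simp
qed

section \<open>Dominoes, positions and the filling of a position\<close>

abbreviation vdom :: "nat \<Rightarrow> nat \<Rightarrow> domino" where
  "vdom i j \<equiv> {(i, j), (Suc i, j)}"

abbreviation hdom :: "nat \<Rightarrow> nat \<Rightarrow> domino" where
  "hdom i j \<equiv> {(i, j), (i, Suc j)}"

lemma vdom_eq_iff: "vdom i j = vdom i' j' \<longleftrightarrow> i = i' \<and> j = j'"
  by (auto simp: doubleton_eq_iff)

lemma hdom_eq_iff: "hdom i j = hdom i' j' \<longleftrightarrow> i = i' \<and> j = j'"
  by (auto simp: doubleton_eq_iff)

lemma vdom_neq_hdom: "vdom i j \<noteq> hdom i' j'" "hdom i' j' \<noteq> vdom i j"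
  by (auto simp: doubleton_eq_iff)

lemma vdom_in_vertical: "vdom i j \<in> vertical_dominoes m n \<longleftrightarrow> Suc i < m \<and> j < n"
  unfolding vertical_dominoes_def by (auto simp only: mem_Collect_eq vdom_eq_iff)

lemma hdom_in_horizontal: "hdom i j \<in> horizontal_dominoes m n \<longleftrightarrow> i < m \<and> Suc j < n"
  unfolding horizontal_dominoes_def by (auto simp only: mem_Collect_eq hdom_eq_iff)

lemma vdom_notin_horizontal: "vdom i j \<notin> horizontal_dominoes m n"
  unfolding horizontal_dominoes_def by (auto simp only: mem_Collect_eq vdom_neq_hdom)

lemma hdom_notin_vertical: "hdom i j \<notin> vertical_dominoes m n"
  unfolding vertical_dominoes_def by (auto simp only: mem_Collect_eq vdom_neq_hdom)

lemma vdom_in_dominoes: "vdom i j \<in> dominoes m n \<longleftrightarrow> Suc i < m \<and> j < n"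
  by (simp only: dominoes_def Un_iff vdom_in_vertical vdom_notin_horizontal simp_thms)

lemma hdom_in_dominoes: "hdom i j \<in> dominoes m n \<longleftrightarrow> i < m \<and> Suc j < n"
  by (simp only: dominoes_def Un_iff hdom_in_horizontal hdom_notin_vertical simp_thms)

lemma dominoes_cases:
  assumes "d \<in> dominoes m n"
  obtains i j where "d = vdom i j" "Suc i < m" "j < n"
    | i j where "d = hdom i j" "i < m" "Suc j < n"
  using assms unfolding dominoes_def vertical_dominoes_def horizontal_dominoes_def by blast

lemma bex_dominoes_iff:
  "(\<exists>d\<in>dominoes m n. Q d) \<longleftrightarrow>
     (\<exists>i j. Suc i < m \<and> j < n \<and> Q (vdom i j)) \<or> (\<exists>i j. i < m \<and> Suc j < n \<and> Q (hdom i j))"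
  unfolding dominoes_def vertical_dominoes_def horizontal_dominoes_def by blast

text \<open>The existential form of the last two tests, rather than \<open>i - 1\<close> and
  \<open>j - 1\<close>, avoids truncated subtraction at the border.\<close>

definition cell_at :: "domino set \<Rightarrow> nat \<Rightarrow> nat \<Rightarrow> cell" where
  "cell_at P i j =
    (if vdom i j \<in> P then VT else if hdom i j \<in> P then HL
     else if \<exists>i'. i = Suc i' \<and> vdom i' j \<in> P then VB
     else if \<exists>j'. j = Suc j' \<and> hdom i j' \<in> P then HR else Empty)"

lemma position_unique:
  assumes "position m n P" "d \<in> P" "e \<in> P" "x \<in> d" "x \<in> e"
  shows "d = e"
  using assms unfolding position_def pairwise_def disjnt_def by blast

text \<open>The four dominoes tested in \<open>cell_at\<close> all contain \<open>(i, j)\<close>, so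
  disjointness admits at most one of them and the order of the tests is immaterial.\<close>

lemma cell_at_iff:
  assumes P: "position m n P"
  shows "cell_at P i j = VT \<longleftrightarrow> vdom i j \<in> P"
    and "cell_at P i j = HL \<longleftrightarrow> hdom i j \<in> P"
    and "cell_at P i j = VB \<longleftrightarrow> (\<exists>i'. i = Suc i' \<and> vdom i' j \<in> P)"
    and "cell_at P i j = HR \<longleftrightarrow> (\<exists>j'. j = Suc j' \<and> hdom i j' \<in> P)"
proof -
  define A B C D where "A \<longleftrightarrow> vdom i j \<in> P" and "B \<longleftrightarrow> hdom i j \<in> P"
    and "C \<longleftrightarrow> (\<exists>i'. i = Suc i' \<and> vdom i' j \<in> P)"
    and "D \<longleftrightarrow> (\<exists>j'. j = Suc j' \<and> hdom i j' \<in> P)"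
  note u = position_unique[OF P, of _ _ "(i, j)"]
  have "\<not> (A \<and> B)"
    using u[of "vdom i j" "hdom i j"] vdom_neq_hdom unfolding A_def B_def by blast
  moreover have False if "vdom i j \<in> P" "i = Suc i'" "vdom i' j \<in> P" for i'
    using u[OF that(1,3)] by (simp add: that(2) doubleton_eq_iff)
  then have "\<not> (A \<and> C)"
    unfolding A_def C_def by blast
  moreover have False if "vdom i j \<in> P" "j = Suc j'" "hdom i j' \<in> P" for j'
    using u[OF that(1,3)] by (simp add: that(2) doubleton_eq_iff)
  then have "\<not> (A \<and> D)"
    unfolding A_def D_def by blast
  moreover have False if "hdom i j \<in> P" "i = Suc i'" "vdom i' j \<in> P" for i'
    using u[OF that(1,3)] by (simp add: that(2) doubleton_eq_iff)
  then have "\<not> (B \<and> C)"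
    unfolding B_def C_def by blast
  moreover have False if "hdom i j \<in> P" "j = Suc j'" "hdom i j' \<in> P" for j'
    using u[OF that(1,3)] by (simp add: that(2) doubleton_eq_iff)
  then have "\<not> (B \<and> D)"
    unfolding B_def D_def by blast
  moreover have False if "i = Suc i'" "vdom i' j \<in> P" "j = Suc j'" "hdom i j' \<in> P" for i' j'
    using u[OF that(2,4)] by (simp add: that(1,3) doubleton_eq_iff)
  then have "\<not> (C \<and> D)"
    unfolding C_def D_def by blast
  moreover have "cell_at P i j = (if A then VT else if B then HL else if C then VB else if D then HR else Empty)"
    by (simp only: cell_at_def A_def B_def C_def D_def)
  ultimately have "(cell_at P i j = VT \<longleftrightarrow> A) \<and> (cell_at P i j = HL \<longleftrightarrow> B) \<and>
      (cell_at P i j = VB \<longleftrightarrow> C) \<and> (cell_at P i j = HR \<longleftrightarrow> D)"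
    by simp
  then show "cell_at P i j = VT \<longleftrightarrow> vdom i j \<in> P"
    and "cell_at P i j = HL \<longleftrightarrow> hdom i j \<in> P"
    and "cell_at P i j = VB \<longleftrightarrow> (\<exists>i'. i = Suc i' \<and> vdom i' j \<in> P)"
    and "cell_at P i j = HR \<longleftrightarrow> (\<exists>j'. j = Suc j' \<and> hdom i j' \<in> P)"
    unfolding A_def B_def C_def D_def by blast+
qed

lemma covered_iff:
  assumes "P \<subseteq> dominoes m n"
  shows "(i, j) \<in> \<Union>P \<longleftrightarrow> cell_at P i j \<noteq> Empty"
proof
  assume "(i, j) \<in> \<Union>P"
  then obtain d where d: "d \<in> P" "(i, j) \<in> d" by blast
  with assms have "d \<in> dominoes m n" by blast
  then show "cell_at P i j \<noteq> Empty"
    by (cases rule: dominoes_cases) (use d in \<open>auto simp: cell_at_def\<close>)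
next
  assume "cell_at P i j \<noteq> Empty"
  then show "(i, j) \<in> \<Union>P"
    unfolding cell_at_def by (auto split: if_splits)
qed

text \<open>A further domino fits exactly when both its squares are uncovered, which
  \<open>covered_iff\<close> translates into \<open>Empty\<close>.\<close>

lemma maximal_position_iff:
  "maximal_position m n P \<longleftrightarrow> position m n P \<and>
     (\<forall>i j. Suc i < m \<and> j < n \<longrightarrow> \<not> (cell_at P i j = Empty \<and> cell_at P (Suc i) j = Empty)) \<and>
     (\<forall>i j. i < m \<and> Suc j < n \<longrightarrow> \<not> (cell_at P i j = Empty \<and> cell_at P i (Suc j) = Empty))"
proof (cases "position m n P")
  case True
  then have P: "P \<subseteq> dominoes m n" by (simp add: position_def)
  have v: "vdom i j \<inter> \<Union>P = {} \<longleftrightarrow> cell_at P i j = Empty \<and> cell_at P (Suc i) j = Empty" for i j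
    using covered_iff[OF P, of i j] covered_iff[OF P, of "Suc i" j] by blast
  have h: "hdom i j \<inter> \<Union>P = {} \<longleftrightarrow> cell_at P i j = Empty \<and> cell_at P i (Suc j) = Empty" for i j
    using covered_iff[OF P, of i j] covered_iff[OF P, of i "Suc j"] by blast
  have "(\<exists>d\<in>dominoes m n. d \<inter> \<Union>P = {}) \<longleftrightarrow>
     (\<exists>i j. Suc i < m \<and> j < n \<and> vdom i j \<inter> \<Union>P = {}) \<or>
     (\<exists>i j. i < m \<and> Suc j < n \<and> hdom i j \<inter> \<Union>P = {})"
    by (rule bex_dominoes_iff)
  then show ?thesis
    unfolding maximal_position_def v h using True by blast
qed (simp add: maximal_position_def)

lemma tiling_cell_at:
  assumes "maximal_position m n P"
  shows "tiling m n (cell_at P)"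
proof -
  have P: "position m n P" using assms by (simp add: maximal_position_def)
  then have "P \<subseteq> dominoes m n" by (simp add: position_def)
  then have v: "vdom i j \<in> P \<Longrightarrow> Suc i < m" and h: "hdom i j \<in> P \<Longrightarrow> Suc j < n" for i j
    using vdom_in_dominoes hdom_in_dominoes by blast+
  show ?thesis
    unfolding tiling_def
  proof (intro allI impI conjI)
    fix i j assume "i < m" "j < n"
    show "Suc j < n" if "cell_at P i j = HL"
      using that h unfolding cell_at_iff[OF P] by blast
    show "Suc i < m" if "cell_at P i j = VT"
      using that v unfolding cell_at_iff[OF P] by blast
    show "j \<noteq> 0" if "cell_at P i j = HR"
      using that unfolding cell_at_iff[OF P] by blast
    show "i \<noteq> 0" if "cell_at P i j = VB"
      using that unfolding cell_at_iff[OF P] by blast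
    \<comment> \<open>Both \<open>cell_at P i j = HL\<close> and
      \<open>cell_at P i (Suc j) = HR\<close> mean \<open>hdom i j \<in> P\<close>; the remaining
      conjunct is maximality.\<close>
    show "hstep (cell_at P i j) (cell_at P i (Suc j))" if "Suc j < n"
      unfolding hstep_def cell_at_iff[OF P]
      using assms \<open>i < m\<close> that by (auto simp only: maximal_position_iff nat.inject)
    show "vstep (cell_at P i j) (cell_at P (Suc i) j)" if "Suc i < m"
      unfolding vstep_def cell_at_iff[OF P]
      using assms \<open>j < n\<close> that by (auto simp only: maximal_position_iff nat.inject)
  qed
qed

section \<open>From fillings back to maximal positions\<close>

definition pos_of :: "nat \<Rightarrow> nat \<Rightarrow> (nat \<Rightarrow> nat \<Rightarrow> cell) \<Rightarrow> domino set" where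
  "pos_of m n t = {vdom i j | i j. i < m \<and> j < n \<and> t i j = VT} \<union>
                  {hdom i j | i j. i < m \<and> j < n \<and> t i j = HL}"

lemma vdom_in_pos_of: "vdom i j \<in> pos_of m n t \<longleftrightarrow> i < m \<and> j < n \<and> t i j = VT"
  unfolding pos_of_def by (auto simp only: Un_iff mem_Collect_eq vdom_eq_iff vdom_neq_hdom)

lemma hdom_in_pos_of: "hdom i j \<in> pos_of m n t \<longleftrightarrow> i < m \<and> j < n \<and> t i j = HL"
  unfolding pos_of_def by (auto simp only: Un_iff mem_Collect_eq hdom_eq_iff vdom_neq_hdom)

text \<open>The border conditions place the partner of each half on the board, and the step
  conditions then fix its cell.\<close>

lemma tilingD:
  assumes "tiling m n t" "i < m" "j < n"
  shows "t i j = HL \<Longrightarrow> Suc j < n \<and> t i (Suc j) = HR"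
    and "t i j = VT \<Longrightarrow> Suc i < m \<and> t (Suc i) j = VB"
    and "t i j = HR \<Longrightarrow> \<exists>j'. j = Suc j' \<and> t i j' = HL"
    and "t i j = VB \<Longrightarrow> \<exists>i'. i = Suc i' \<and> t i' j = VT"
proof -
  note * = assms(1)[unfolded tiling_def, rule_format]
  show "t i j = HL \<Longrightarrow> Suc j < n \<and> t i (Suc j) = HR"
    and "t i j = VT \<Longrightarrow> Suc i < m \<and> t (Suc i) j = VB"
    using *[OF assms(2,3)] by (auto simp: hstep_def vstep_def)
  show "\<exists>j'. j = Suc j' \<and> t i j' = HL" if "t i j = HR"
    using *[OF assms(2,3)] *[OF assms(2), of "j - 1"] assms(3) that
    by (cases j) (auto simp: hstep_def)
  show "\<exists>i'. i = Suc i' \<and> t i' j = VT" if "t i j = VB"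
    using *[OF assms(2,3)] *[OF _ assms(3), of "i - 1"] assms(2) that
    by (cases i) (auto simp: vstep_def)
qed

lemma cell_at_pos_of:
  assumes t: "tiling m n t" and "i < m" "j < n"
  shows "cell_at (pos_of m n t) i j = t i j"
proof (cases "t i j")
  case Empty
  have "t i' j \<noteq> VT" if "i = Suc i'" for i'
    using tilingD(2)[OF t, of i' j] assms that Empty by auto
  moreover have "t i j' \<noteq> HL" if "j = Suc j'" for j'
    using tilingD(1)[OF t, of i j'] assms that Empty by auto
  ultimately show ?thesis
    using Empty by (auto simp: cell_at_def vdom_in_pos_of hdom_in_pos_of)
next
  case HL
  then show ?thesis using assms by (auto simp: cell_at_def vdom_in_pos_of hdom_in_pos_of)
next
  case HR
  then obtain j' where j': "j = Suc j'" "t i j' = HL" using tilingD(3)[OF assms] by blast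
  \<comment> \<open>\<open>cell_at\<close> tests for \<open>VB\<close> before \<open>HR\<close>, so
    a vertical domino from above has to be excluded first.\<close>
  have "t i' j \<noteq> VT" if "i = Suc i'" for i'
    using tilingD(2)[OF t, of i' j] assms that HR by auto
  then show ?thesis
    using HR j' assms by (auto simp: cell_at_def vdom_in_pos_of hdom_in_pos_of)
next
  case VT
  then show ?thesis using assms by (auto simp: cell_at_def vdom_in_pos_of)
next
  case VB
  then obtain i' where "i = Suc i'" "t i' j = VT" using tilingD(4)[OF assms] by blast
  then show ?thesis
    using VB assms by (auto simp: cell_at_def vdom_in_pos_of hdom_in_pos_of)
qed

lemma position_pos_of:
  assumes t: "tiling m n t"
  shows "position m n (pos_of m n t)"
proof -
  have sub: "pos_of m n t \<subseteq> dominoes m n"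
  proof
    fix d assume "d \<in> pos_of m n t"
    then consider i j where "d = vdom i j" "i < m" "j < n" "t i j = VT"
      | i j where "d = hdom i j" "i < m" "j < n" "t i j = HL"
      unfolding pos_of_def by blast
    then show "d \<in> dominoes m n"
      by cases (simp_all only: vdom_in_dominoes hdom_in_dominoes tilingD(1,2)[OF t] simp_thms)
  qed
  \<comment> \<open>Disjointness: the cell at a covered square determines the domino covering it, so
    two dominoes sharing a square coincide. The default branch is met only for
    \<open>HR\<close>.\<close>
  have eq: "e = (case t i j of VT \<Rightarrow> vdom i j | VB \<Rightarrow> vdom (i - 1) j | HL \<Rightarrow> hdom i j | _ \<Rightarrow> hdom i (j - 1))"
    if "e \<in> pos_of m n t" "(i, j) \<in> e" for e i j
    using that tilingD(1,2)[OF t] unfolding pos_of_def by auto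
  have "d = e" if "d \<in> pos_of m n t" "e \<in> pos_of m n t" "x \<in> d" "x \<in> e" for d e x
    using that eq[of d "fst x" "snd x"] eq[of e "fst x" "snd x"] by simp
  then show ?thesis
    unfolding position_def pairwise_def disjnt_def using sub by blast
qed

lemma maximal_position_pos_of:
  assumes t: "tiling m n t"
  shows "maximal_position m n (pos_of m n t)"
  unfolding maximal_position_iff
  using position_pos_of[OF t] t
  by (auto simp: cell_at_pos_of tiling_def hstep_def vstep_def)

text \<open>Agreement on the board suffices because \<open>pos_of\<close> inspects nothing else;
  this permits list lookups for \<open>t\<close>, which are unspecified outside the board.\<close>

lemma pos_of_cell_at:
  assumes P: "position m n P" and t: "\<And>i j. i < m \<Longrightarrow> j < n \<Longrightarrow> t i j = cell_at P i j"
  shows "pos_of m n t = P"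
proof -
  have sub: "P \<subseteq> dominoes m n" using P by (simp add: position_def)
  show ?thesis
  proof (intro equalityI subsetI)
    fix d assume "d \<in> pos_of m n t"
    then show "d \<in> P"
      unfolding pos_of_def by (auto simp: t cell_at_iff[OF P])
  next
    fix d assume d: "d \<in> P"
    with sub have "d \<in> dominoes m n" by blast
    then show "d \<in> pos_of m n t"
    proof (cases rule: dominoes_cases)
      case (1 i j)
      then show ?thesis using d by (simp only: vdom_in_pos_of) (simp add: t cell_at_iff[OF P])
    next
      case (2 i j)
      then show ?thesis using d by (simp only: hdom_in_pos_of) (simp add: t cell_at_iff[OF P])
    qed
  qed
qed

section \<open>Counting dominoes and rewriting the generating function\<close>

lemma card_vertical:
  assumes P: "position m n P"
  shows "card {(i, j). i < m \<and> j < n \<and> cell_at P i j = VT} = card (P \<inter> vertical_dominoes m n)"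
proof (rule bij_betw_same_card[of "\<lambda>(i, j). vdom i j"])
  have sub: "P \<subseteq> dominoes m n" using P by (simp add: position_def)
  show "bij_betw (\<lambda>(i, j). vdom i j) {(i, j). i < m \<and> j < n \<and> cell_at P i j = VT}
      (P \<inter> vertical_dominoes m n)"
    unfolding bij_betw_def
  proof
    show "inj_on (\<lambda>(i, j). vdom i j) {(i, j). i < m \<and> j < n \<and> cell_at P i j = VT}"
      by (auto simp: inj_on_def doubleton_eq_iff)
    have "vdom i j \<in> P \<Longrightarrow> i < m \<and> Suc i < m \<and> j < n" for i j
      using sub vdom_in_dominoes Suc_lessD by blast
    then show "(\<lambda>(i, j). vdom i j) ` {(i, j). i < m \<and> j < n \<and> cell_at P i j = VT} =
        P \<inter> vertical_dominoes m n"
      by (fastforce simp: cell_at_iff[OF P] vertical_dominoes_def image_iff)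
  qed
qed

lemma card_horizontal:
  assumes P: "position m n P"
  shows "card {(i, j). i < m \<and> j < n \<and> cell_at P i j = HR} = card (P \<inter> horizontal_dominoes m n)"
\<comment> \<open>The domino of a right half starts one column further left;
  \<open>cell_at_iff\<close> guarantees \<open>j > 0\<close>, so the subtraction stays
  injective.\<close>
proof (rule bij_betw_same_card[of "\<lambda>(i, j). hdom i (j - 1)"])
  have sub: "P \<subseteq> dominoes m n" using P by (simp add: position_def)
  show "bij_betw (\<lambda>(i, j). hdom i (j - 1)) {(i, j). i < m \<and> j < n \<and> cell_at P i j = HR}
      (P \<inter> horizontal_dominoes m n)"
    unfolding bij_betw_def
  proof
    show "inj_on (\<lambda>(i, j). hdom i (j - 1)) {(i, j). i < m \<and> j < n \<and> cell_at P i j = HR}"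
      by (auto simp: inj_on_def doubleton_eq_iff cell_at_iff[OF P])
    have "hdom i j \<in> P \<Longrightarrow> i < m \<and> Suc j < n" for i j
      using sub hdom_in_dominoes by blast
    then show "(\<lambda>(i, j). hdom i (j - 1)) ` {(i, j). i < m \<and> j < n \<and> cell_at P i j = HR} =
        P \<inter> horizontal_dominoes m n"
      by (fastforce simp: cell_at_iff[OF P] horizontal_dominoes_def image_iff)
  qed
qed

text \<open>Grouping the maximal positions by their pair of domino counts: each fibre contributes
  its cardinality times one monomial.\<close>

lemma gen_fun_eq:
  "gen_fun m n = (\<Sum>P | maximal_position m n P.
     X ^ card (P \<inter> vertical_dominoes m n) * Y ^ card (P \<inter> horizontal_dominoes m n))"
proof -
  let ?M = "{P. maximal_position m n P}"
  let ?g = "\<lambda>P. (card (P \<inter> vertical_dominoes m n), card (P \<inter> horizontal_dominoes m n))"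
  let ?f = "\<lambda>(a, b). of_nat (num_maximal m n a b) * X ^ a * Y ^ b"
  have fib: "num_maximal m n a b = card {P \<in> ?M. ?g P = (a, b)}" for a b
    unfolding num_maximal_def by (intro arg_cong[of _ _ card]) auto
  \<comment> \<open>The support lies in a finite image, which turns \<open>Sum_any\<close> into an
    ordinary sum over it.\<close>
  have "{p. ?f p \<noteq> 0} \<subseteq> ?g ` ?M"
  proof clarify
    fix a b assume "of_nat (num_maximal m n a b) * X ^ a * Y ^ b \<noteq> 0"
    then have "num_maximal m n a b \<noteq> 0" by (metis mult_zero_left of_nat_0)
    then have "{P \<in> ?M. ?g P = (a, b)} \<noteq> {}" unfolding fib by (metis card.empty)
    then show "(a, b) \<in> ?g ` ?M" by force
  qed
  then have "gen_fun m n = sum ?f (?g ` ?M)"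
    unfolding gen_fun_def by (intro Sum_any.expand_superset) (auto simp: finite_maximal_positions)
  also have "\<dots> = (\<Sum>p\<in>?g ` ?M. \<Sum>P | P \<in> ?M \<and> ?g P = p. X ^ fst (?g P) * Y ^ snd (?g P))"
  proof (rule sum.cong[OF refl])
    fix p :: "nat \<times> nat"
    obtain a b where p: "p = (a, b)" by fastforce
    have "(\<Sum>P | P \<in> ?M \<and> ?g P = p. X ^ fst (?g P) * Y ^ snd (?g P)) =
      (\<Sum>P | P \<in> ?M \<and> ?g P = p. X ^ a * Y ^ b)"
      by (intro sum.cong) (auto simp: p)
    then show "?f p = (\<Sum>P | P \<in> ?M \<and> ?g P = p. X ^ fst (?g P) * Y ^ snd (?g P))"
      unfolding p prod.case fib by simp
  qed
  also have "\<dots> = (\<Sum>P\<in>?M. X ^ fst (?g P) * Y ^ snd (?g P))"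
    by (rule sum.image_gen[OF finite_maximal_positions, symmetric])
  finally show ?thesis by simp
qed

section \<open>The weight-preserving bijection and the conclusion\<close>

definition grid_of :: "nat \<Rightarrow> nat \<Rightarrow> domino set \<Rightarrow> cell list list" where
  "grid_of m n P = map (\<lambda>i. map (cell_at P i) [0..<n]) [0..<m]"

lemma grid_of_nth: "i < m \<Longrightarrow> j < n \<Longrightarrow> grid_of m n P ! i ! j = cell_at P i j"
  by (simp add: grid_of_def)

lemma grid_of_in_grids: "grid_of m n P \<in> grids m n"
  by (auto simp: grid_of_def)

lemma tiling_cong:
  assumes "\<And>i j. i < m \<Longrightarrow> j < n \<Longrightarrow> t i j = t' i j"
  shows "tiling m n t \<longleftrightarrow> tiling m n t'"
  unfolding tiling_def using assms by (auto simp: Suc_lessD)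

text \<open>\<open>grid_of\<close> and \<open>pos_of\<close> are mutually inverse between maximal
  positions and grids that are tilings, and \<open>gwt_eq\<close> with the two counting lemmas
  matches the weights.\<close>

lemma gen_fun_eq_sum_grids:
  "gen_fun m n = (\<Sum>G | G \<in> grids m n \<and> tiling m n (\<lambda>i j. G ! i ! j). gwt G)"
  unfolding gen_fun_eq
proof (rule sum.reindex_bij_witness[of _ "\<lambda>G. pos_of m n (\<lambda>i j. G ! i ! j)" "grid_of m n"])
  fix P assume "P \<in> {P. maximal_position m n P}"
  then have M: "maximal_position m n P" and P: "position m n P"
    by (simp_all add: maximal_position_def)
  show "pos_of m n (\<lambda>i j. grid_of m n P ! i ! j) = P"
    by (rule pos_of_cell_at[OF P grid_of_nth])
  have "tiling m n (\<lambda>i j. grid_of m n P ! i ! j) \<longleftrightarrow> tiling m n (cell_at P)"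
    by (rule tiling_cong) (rule grid_of_nth)
  then show "grid_of m n P \<in> {G. G \<in> grids m n \<and> tiling m n (\<lambda>i j. G ! i ! j)}"
    using tiling_cell_at[OF M] grid_of_in_grids by blast
  have "{(i, j). i < m \<and> j < n \<and> grid_of m n P ! i ! j = c} =
      {(i, j). i < m \<and> j < n \<and> cell_at P i j = c}" for c
    by (auto simp: grid_of_nth)
  then show "gwt (grid_of m n P) =
      X ^ card (P \<inter> vertical_dominoes m n) * Y ^ card (P \<inter> horizontal_dominoes m n)"
    by (simp only: gwt_eq[OF grid_of_in_grids] card_vertical[OF P] card_horizontal[OF P])
next
  fix G assume "G \<in> {G. G \<in> grids m n \<and> tiling m n (\<lambda>i j. G ! i ! j)}"
  then have G: "G \<in> grids m n" and t: "tiling m n (\<lambda>i j. G ! i ! j)" by auto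
  have "length G = m" using G by simp
  then show "grid_of m n (pos_of m n (\<lambda>i j. G ! i ! j)) = G"
    using grid_nth_length[OF G] cell_at_pos_of[OF t]
    by (auto intro!: nth_equalityI simp: grid_of_def)
  show "pos_of m n (\<lambda>i j. G ! i ! j) \<in> {P. maximal_position m n P}"
    using maximal_position_pos_of[OF t] by simp
qed

theorem theorem8:
  fixes m n :: nat
  assumes "m \<ge> 1" and "n \<ge> 1"
  shows "gen_fun m n =
    (\<Sum>u \<in> {1..n} \<rightarrow>\<^sub>E {0, 1::nat}.
       entry ((M0 n + M0' n) ^\<^sub>m m) (1 + (\<Sum>i = 1..n. u i * 3 ^ (i - 1))) 1)"
  unfolding gen_fun_eq_sum_grids sum_entries[OF assms(1)] ..

end
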